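(* Let $(X,\cdot)$ be a right P{\l}onka magma, with a decomposition $X=\coprod_{i\in I}X_i$ and functions $f_i^j:X_i\to X_i$ ($i,j\in I$) satisfying $f_i^j\circ f_i^k=f_i^k\circ f_i^j$ for all $i,j,k\in I$ and $x_i\cdot x_j=f_i^j(x_i)$ for all $x_i\in X_i$, $x_j\in X_j$. The following conditions are equivalent: (1) $(X,\cdot)$ is left ideal-simple. (2) $(X,\cdot)$ is ideal-simple. (3) $(X,\cdot)$ is total, in the sense that $X^2=X$. (4) For every $i\in I$ the functions $f_i^j:X_i\to X_i$, $j\in I$, are jointly onto, in the sense that $\bigcup_{j\in I}\mathrm{Im}\,f_i^j=X_i$.
   Context: A right P{\l}onka magma is a set $X$ with a binary operation such that $(x\cdot y)\cdot z=(x\cdot z)\cdot y$ and $x\cdot(y\cdot z)=x\cdot y$ for all $x,y,z\in X$; every right P{\l}onka magma admits a decomposition as in the statement. Parts of a partition are non-empty. A non-empty subset $J\subseteq X$ is a left ideal if $x\cdot a\in J$ for all $x\in X$, $a\in J$; a right ideal if $a\cdot x\in J$ for all $a\in J$, $x\in X$; and a two-sided ideal if it is both. The magma is left ideal-simple if it has no proper non-empty left ideals, and ideal-simple if it has no proper non-empty two-sided ideals. $X^2=\{x\cdot y\mid x,y\in X\}$. *)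

theory Defs
  imports Main "HOL-Library.FuncSet" "HOL-Library.Disjoint_Sets"
begin

text \<open>Magmas are given by a carrier set \<open>X\<close>, possibly empty, and an operation \<open>m\<close> that is only
  meaningful on \<open>X\<close>.\<close>

definition right_plonka_magma :: "'a set \<Rightarrow> ('a \<Rightarrow> 'a \<Rightarrow> 'a) \<Rightarrow> bool" where
  "right_plonka_magma X m \<longleftrightarrow>
     (\<forall>x\<in>X. \<forall>y\<in>X. m x y \<in> X) \<and>
     (\<forall>x\<in>X. \<forall>y\<in>X. \<forall>z\<in>X. m (m x y) z = m (m x z) y) \<and>
     (\<forall>x\<in>X. \<forall>y\<in>X. \<forall>z\<in>X. m x (m y z) = m x y)"

definition left_ideal :: "'a set \<Rightarrow> ('a \<Rightarrow> 'a \<Rightarrow> 'a) \<Rightarrow> 'a set \<Rightarrow> bool" where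
  "left_ideal X m J \<longleftrightarrow> J \<noteq> {} \<and> J \<subseteq> X \<and> (\<forall>x\<in>X. \<forall>a\<in>J. m x a \<in> J)"

definition right_ideal :: "'a set \<Rightarrow> ('a \<Rightarrow> 'a \<Rightarrow> 'a) \<Rightarrow> 'a set \<Rightarrow> bool" where
  "right_ideal X m J \<longleftrightarrow> J \<noteq> {} \<and> J \<subseteq> X \<and> (\<forall>a\<in>J. \<forall>x\<in>X. m a x \<in> J)"

definition two_sided_ideal :: "'a set \<Rightarrow> ('a \<Rightarrow> 'a \<Rightarrow> 'a) \<Rightarrow> 'a set \<Rightarrow> bool" where
  "two_sided_ideal X m J \<longleftrightarrow> left_ideal X m J \<and> right_ideal X m J"

definition left_ideal_simple :: "'a set \<Rightarrow> ('a \<Rightarrow> 'a \<Rightarrow> 'a) \<Rightarrow> bool" where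
  "left_ideal_simple X m \<longleftrightarrow> \<not> (\<exists>J. left_ideal X m J \<and> J \<noteq> X)"

definition ideal_simple :: "'a set \<Rightarrow> ('a \<Rightarrow> 'a \<Rightarrow> 'a) \<Rightarrow> bool" where
  "ideal_simple X m \<longleftrightarrow> \<not> (\<exists>J. two_sided_ideal X m J \<and> J \<noteq> X)"

definition magma_square :: "'a set \<Rightarrow> ('a \<Rightarrow> 'a \<Rightarrow> 'a) \<Rightarrow> 'a set" where
  "magma_square X m = {m x y | x y. x \<in> X \<and> y \<in> X}"

definition total_magma :: "'a set \<Rightarrow> ('a \<Rightarrow> 'a \<Rightarrow> 'a) \<Rightarrow> bool" where
  "total_magma X m \<longleftrightarrow> magma_square X m = X"

text \<open>\<open>f i j\<close> stands for \<open>f\<^sub>i\<^sup>j\<close>: the first index names the part on which the map acts.\<close>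

definition plonka_decomposition ::
  "'a set \<Rightarrow> ('a \<Rightarrow> 'a \<Rightarrow> 'a) \<Rightarrow> 'i set \<Rightarrow> ('i \<Rightarrow> 'a set) \<Rightarrow> ('i \<Rightarrow> 'i \<Rightarrow> 'a \<Rightarrow> 'a) \<Rightarrow> bool" where
  "plonka_decomposition X m I P f \<longleftrightarrow>
     (\<Union>i\<in>I. P i) = X \<and>
     disjoint_family_on P I \<and>
     (\<forall>i\<in>I. P i \<noteq> {}) \<and>
     (\<forall>i\<in>I. \<forall>j\<in>I. f i j \<in> P i \<rightarrow> P i) \<and>
     (\<forall>i\<in>I. \<forall>j\<in>I. \<forall>k\<in>I. \<forall>x\<in>P i. (f i j \<circ> f i k) x = (f i k \<circ> f i j) x) \<and>
     (\<forall>i\<in>I. \<forall>j\<in>I. \<forall>x\<in>P i. \<forall>y\<in>P j. m x y = f i j x)"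

end

theory Submission
  imports Defs
begin

text \<open>If \<open>X\<^sup>2 = X\<close> and \<open>a\<close> lies in a left ideal \<open>J\<close>, then every \<open>x = y \<cdot> z\<close> equals
  \<open>y \<cdot> (z \<cdot> a)\<close>, which lies in \<open>J\<close>. Conversely, \<open>X\<^sup>2\<close> is itself a two-sided ideal
  unless \<open>X\<close> is empty. Condition (4) is totality read part by part, since \<open>y \<cdot> z\<close> always lies in the
  part of \<open>y\<close>.\<close>

lemma left_ideal_simple_imp_ideal_simple:
  "left_ideal_simple X m \<Longrightarrow> ideal_simple X m"
  unfolding left_ideal_simple_def ideal_simple_def two_sided_ideal_def by blast

text \<open>Every product of two elements of \<open>X\<close> lies in the square, so absorption is
  automatic on both sides once \<open>closed\<close> places the square inside
  \<open>X\<close>.\<close>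

lemma two_sided_ideal_magma_square:
  assumes closed: "\<And>x y. x \<in> X \<Longrightarrow> y \<in> X \<Longrightarrow> m x y \<in> X" and "X \<noteq> {}"
  shows "two_sided_ideal X m (magma_square X m)"
proof -
  have "magma_square X m \<subseteq> X"
    using closed by (auto simp: magma_square_def)
  moreover have "magma_square X m \<noteq> {}"
    using \<open>X \<noteq> {}\<close> by (auto simp: magma_square_def)
  moreover have "m x y \<in> magma_square X m" if "x \<in> X" "y \<in> X" for x y
    using that by (auto simp: magma_square_def)
  ultimately show ?thesis
    unfolding two_sided_ideal_def left_ideal_def right_ideal_def by blast
qed

lemma ideal_simple_imp_total_magma:
  assumes closed: "\<And>x y. x \<in> X \<Longrightarrow> y \<in> X \<Longrightarrow> m x y \<in> X" and "ideal_simple X m"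
  shows "total_magma X m"
proof (cases "X = {}")
  \<comment> \<open>Ideals are non-empty by definition, so the empty magma is treated separately:
    its square is empty and hence all of \<open>X\<close>.\<close>
  case True
  then show ?thesis by (simp add: total_magma_def magma_square_def)
next
  case False
  then show ?thesis
    using two_sided_ideal_magma_square[of X m, OF closed] \<open>ideal_simple X m\<close>
    unfolding ideal_simple_def total_magma_def by blast
qed

lemma total_magma_imp_left_ideal_simple:
  assumes plonka: "right_plonka_magma X m" and total: "total_magma X m"
  shows "left_ideal_simple X m"
proof -
  have "X \<subseteq> J" if J: "left_ideal X m J" for J
  proof
    fix x assume "x \<in> X"
    then have "x \<in> magma_square X m"
      using total by (simp add: total_magma_def)
    then obtain y z where yz: "y \<in> X" "z \<in> X" "x = m y z"
      by (auto simp: magma_square_def)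
    obtain a where a: "a \<in> J" "a \<in> X"
      using J by (auto simp: left_ideal_def)
    \<comment> \<open>The law \<open>m y (m z a) = m y z\<close>, read from right to left, inserts
      the element \<open>a\<close> of \<open>J\<close>. Absorption then applies twice, first for
      \<open>z\<close> and then for \<open>y\<close>.\<close>
    have "x = m y (m z a)"
      using plonka yz a by (simp add: right_plonka_magma_def)
    then show "x \<in> J"
      using J yz a by (simp add: left_ideal_def)
  qed
  then show ?thesis
    by (auto simp: left_ideal_simple_def left_ideal_def)
qed

lemma total_magma_iff_jointly_onto:
  assumes "plonka_decomposition X m I P f"
  shows "total_magma X m \<longleftrightarrow> (\<forall>i\<in>I. (\<Union>j\<in>I. f i j ` P i) = P i)"
proof -
  have X: "X = (\<Union>i\<in>I. P i)"
    and disj: "\<And>i k x. i \<in> I \<Longrightarrow> k \<in> I \<Longrightarrow> x \<in> P i \<Longrightarrow> x \<in> P k \<Longrightarrow> i = k"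
    and nonempty: "\<And>i. i \<in> I \<Longrightarrow> P i \<noteq> {}"
    and maps: "\<And>i j x. i \<in> I \<Longrightarrow> j \<in> I \<Longrightarrow> x \<in> P i \<Longrightarrow> f i j x \<in> P i"
    and m: "\<And>i j x y. i \<in> I \<Longrightarrow> j \<in> I \<Longrightarrow> x \<in> P i \<Longrightarrow> y \<in> P j \<Longrightarrow> m x y = f i j x"
    using assms by (auto simp: plonka_decomposition_def disjoint_family_on_def Pi_iff)
  \<comment> \<open>The square is the union over all parts of the sets whose equality with
    \<open>P i\<close> is to be compared with totality.\<close>
  have square: "magma_square X m = (\<Union>i\<in>I. \<Union>j\<in>I. f i j ` P i)"
  proof (intro set_eqI iffI)
    fix x assume "x \<in> magma_square X m"
    then obtain y z where "y \<in> X" "z \<in> X" and x: "x = m y z"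
      by (auto simp: magma_square_def)
    then obtain i j where ij: "i \<in> I" "y \<in> P i" "j \<in> I" "z \<in> P j"
      unfolding X by blast
    then have "x = f i j y" using m x by simp
    then show "x \<in> (\<Union>i\<in>I. \<Union>j\<in>I. f i j ` P i)"
      using ij by blast
  next
    fix x assume "x \<in> (\<Union>i\<in>I. \<Union>j\<in>I. f i j ` P i)"
    then obtain i j y where "i \<in> I" "j \<in> I" "y \<in> P i" "x = f i j y" by blast
    \<comment> \<open>Since \<open>P j\<close> is non-empty, \<open>f i j\<close> is realised on
      \<open>P i\<close> as right multiplication by some \<open>z\<close>.\<close>
    moreover from \<open>j \<in> I\<close> obtain z where "z \<in> P j" using nonempty by blast
    ultimately have "x = m y z" "y \<in> X" "z \<in> X"
      using m[of i j y z] unfolding X by auto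
    then show "x \<in> magma_square X m" by (auto simp: magma_square_def)
  qed
  have sub: "(\<Union>j\<in>I. f i j ` P i) \<subseteq> P i" if "i \<in> I" for i
    using maps that by blast
  show ?thesis
  proof
    assume "total_magma X m"
    then have union: "X = (\<Union>i\<in>I. \<Union>j\<in>I. f i j ` P i)"
      unfolding total_magma_def square by (rule sym)
    \<comment> \<open>Totality only gives a preimage of \<open>x\<close> in some part
      \<open>P k\<close>. The maps on \<open>P k\<close> stay in \<open>P k\<close>, so
      \<open>x\<close> lies there too, and disjointness forces \<open>k = i\<close>.\<close>
    have "x \<in> (\<Union>j\<in>I. f i j ` P i)" if i: "i \<in> I" and x: "x \<in> P i" for i x
    proof -
      have "x \<in> X" unfolding X using i x by (rule UN_I)
      then have "x \<in> (\<Union>k\<in>I. \<Union>j\<in>I. f k j ` P k)" by (subst (asm) union)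
      then obtain k where k: "k \<in> I" "x \<in> (\<Union>j\<in>I. f k j ` P k)" by (rule UN_E)
      have "x \<in> P k" using sub[OF k(1)] k(2) by (rule subsetD)
      with k(1) i have "k = i" using x by (rule disj)
      then show ?thesis using k(2) by simp
    qed
    then show "\<forall>i\<in>I. (\<Union>j\<in>I. f i j ` P i) = P i"
      by (intro ballI subset_antisym sub subsetI)
  next
    assume "\<forall>i\<in>I. (\<Union>j\<in>I. f i j ` P i) = P i"
    then have "(\<Union>i\<in>I. \<Union>j\<in>I. f i j ` P i) = (\<Union>i\<in>I. P i)"
      by (intro SUP_cong refl) (rule bspec)
    then show "total_magma X m"
      unfolding total_magma_def square by (simp only: X)
  qed
qed

theorem theorem3p21:
  fixes X :: "'a set" and m :: "'a \<Rightarrow> 'a \<Rightarrow> 'a"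
    and I :: "'i set" and P :: "'i \<Rightarrow> 'a set" and f :: "'i \<Rightarrow> 'i \<Rightarrow> 'a \<Rightarrow> 'a"
  assumes "right_plonka_magma X m"
    and "plonka_decomposition X m I P f"
  shows "(left_ideal_simple X m \<longleftrightarrow> ideal_simple X m) \<and>
         (ideal_simple X m \<longleftrightarrow> total_magma X m) \<and>
         (total_magma X m \<longleftrightarrow> (\<forall>i\<in>I. (\<Union>j\<in>I. f i j ` P i) = P i))"
proof -
  have "\<And>x y. x \<in> X \<Longrightarrow> y \<in> X \<Longrightarrow> m x y \<in> X"
    using assms(1) by (simp add: right_plonka_magma_def)
  \<comment> \<open>The first three conditions are linked by a cycle of implications; the fourth is
    tied to totality.\<close>
  then show ?thesis
    using left_ideal_simple_imp_ideal_simple[of X m] ideal_simple_imp_total_magma[of X m]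
      total_magma_imp_left_ideal_simple[OF assms(1)] total_magma_iff_jointly_onto[OF assms(2)]
    by blast
qed

end
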